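(* Let $G_{10}$ be the graph with vertex set $\{v\}\cup\{a_1,\dots,a_{10}\}\cup\{b_{ij} : 1\le i<j\le 10\}$, where $v$ is adjacent to every $a_i$, each $b_{ij}$ is adjacent to exactly $a_i$ and $a_j$, and there are no other edges. Then $G_{10}$ is not a veto interval graph.
   Context: All graphs are finite and simple. A veto interval is a triple $I(a)=(a_l,a_v,a_r)$ of real numbers with $a_l<a_v<a_r$ (closed interval $[a_l,a_r]$ with veto mark $a_v$). A veto interval representation of a graph $G$ assigns to each vertex $a$ a veto interval $I(a)$ such that distinct vertices $a,b$ are adjacent if and only if $a_v<b_l<a_r<b_v$ or $b_v<a_l<b_r<a_v$. A graph is a veto interval graph if it has a veto interval representation. *)

theory Defs
  imports Complex_Main "Graph_Theory.Pair_Digraph"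
begin

text \<open>
  Finite simple graphs are rendered by the locale \<^locale>\<open>pair_graph\<close>: finite, loop-free digraphs
  with a symmetric set of arcs, each arc being the ordered pair of its ends. The definitions below
  are meant for such graphs; the lemma \<open>pair_graph_G10\<close> shows that the graph in question is one.
\<close>

record veto_interval =
  left :: real
  veto :: real
  right :: real

definition is_veto_interval :: "veto_interval \<Rightarrow> bool" where
  "is_veto_interval I \<longleftrightarrow> left I < veto I \<and> veto I < right I"

definition veto_adjacent :: "veto_interval \<Rightarrow> veto_interval \<Rightarrow> bool" where
  "veto_adjacent I J \<longleftrightarrow>
     (veto I < left J \<and> left J < right I \<and> right I < veto J) \<or>
     (veto J < left I \<and> left I < right J \<and> right J < veto I)"

definition veto_interval_representation ::
    "'a pair_pre_digraph \<Rightarrow> ('a \<Rightarrow> veto_interval) \<Rightarrow> bool" where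
  "veto_interval_representation G I \<longleftrightarrow>
     (\<forall>a \<in> pverts G. is_veto_interval (I a)) \<and>
     (\<forall>a \<in> pverts G. \<forall>b \<in> pverts G. a \<noteq> b \<longrightarrow>
        (a \<rightarrow>\<^bsub>G\<^esub> b \<longleftrightarrow> veto_adjacent (I a) (I b)))"

definition veto_interval_graph :: "'a pair_pre_digraph \<Rightarrow> bool" where
  "veto_interval_graph G \<longleftrightarrow> (\<exists>I. veto_interval_representation G I)"

datatype vertex = Vv | Va nat | Vb nat nat

definition G10_verts :: "vertex set" where
  "G10_verts = {Vv} \<union> {Va i | i. 1 \<le> i \<and> i \<le> 10} \<union> {Vb i j | i j. 1 \<le> i \<and> i < j \<and> j \<le> 10}"

text \<open>Each edge of the graph is listed in one orientation only.\<close>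

definition G10_edges :: "(vertex \<times> vertex) set" where
  "G10_edges =
     {(Vv, Va i) | i. 1 \<le> i \<and> i \<le> 10} \<union>
     {(Va i, Vb i j) | i j. 1 \<le> i \<and> i < j \<and> j \<le> 10} \<union>
     {(Va j, Vb i j) | i j. 1 \<le> i \<and> i < j \<and> j \<le> 10}"

definition G10 :: "vertex pair_pre_digraph" where
  "G10 = \<lparr> pverts = G10_verts, parcs = G10_edges \<union> G10_edges\<inverse> \<rparr>"

lemma pair_graph_G10: "pair_graph G10"
proof -
  have "G10_verts \<subseteq> {Vv} \<union> Va ` {..10} \<union> (\<lambda>(i, j). Vb i j) ` ({..10} \<times> {..10})"
    by (auto simp: G10_verts_def image_iff)
  then have "finite (pverts G10)"
    by (auto simp: G10_def intro: finite_subset)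
  moreover have "parcs G10 \<subseteq> pverts G10 \<times> pverts G10"
    by (auto simp: G10_def G10_verts_def G10_edges_def)
  moreover have "finite (parcs G10)"
    using calculation finite_subset by blast
  moreover have "fst e \<noteq> snd e" if "e \<in> parcs G10" for e
    using that by (auto simp: G10_def G10_edges_def)
  moreover have "sym (parcs G10)"
    by (auto simp: G10_def sym_def)
  ultimately show ?thesis
    by unfold_locales (auto simp: symmetric_def with_proj_simps)
qed

end

theory Submission
  imports Defs
begin

text \<open>
  Each \<open>a\<^sub>i\<close> lies to the right or to the left of \<open>v\<close>. If three of them lie on each side, take on
  the right one that has neither the leftmost left end nor the rightmost veto mark, and on the left
  its mirror analogue; the vertex \<open>b\<close> joining these two would need its veto mark both to the right
  and to the left of that of \<open>v\<close>. So one side, say the right one, contains at least eight of the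
  \<open>a\<^sub>i\<close>. There every \<open>b\<^sub>i\<^sub>j\<close> lies to the left of both \<open>a\<^sub>i\<close> and \<open>a\<^sub>j\<close> or to the right of both. The pairs
  of the first kind form a 2-degenerate graph (remove the least left end), and so do those of the
  second kind (remove the greatest veto mark). Such graphs on eight vertices have at most 13 edges
  each, fewer than the 28 pairs altogether.
\<close>

section \<open>Orientation of adjacencies and reflection\<close>

definition precedes :: "veto_interval \<Rightarrow> veto_interval \<Rightarrow> bool" where
  "precedes I J \<longleftrightarrow> veto I < left J \<and> left J < right I \<and> right I < veto J"

lemma veto_adjacent_iff: "veto_adjacent I J \<longleftrightarrow> precedes I J \<or> precedes J I"
  by (auto simp: veto_adjacent_def precedes_def)

text \<open>Reflection of the real line at 0. It exchanges the two sides of \<open>v\<close>, so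
  that facts about neighbours to the right of \<open>v\<close> transfer to those on the
  left.\<close>

definition mirror :: "veto_interval \<Rightarrow> veto_interval" where
  "mirror I = \<lparr>left = - right I, veto = - veto I, right = - left I\<rparr>"

lemma veto_mirror [simp]: "veto (mirror I) = - veto I"
  by (simp add: mirror_def)

lemma is_veto_interval_mirror [simp]: "is_veto_interval (mirror I) \<longleftrightarrow> is_veto_interval I"
  by (auto simp: is_veto_interval_def mirror_def)

lemma precedes_mirror [simp]: "precedes (mirror I) (mirror J) \<longleftrightarrow> precedes J I"
  by (auto simp: precedes_def mirror_def)

lemma veto_adjacent_mirror [simp]: "veto_adjacent (mirror I) (mirror J) \<longleftrightarrow> veto_adjacent I J"
  by (auto simp: veto_adjacent_iff)

section \<open>Choosing triples and counting edges of 2-degenerate graphs\<close>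

lemma card_gt_2_obtain:
  assumes "2 < card X"
  obtains x y z where "x \<in> X" "y \<in> X" "z \<in> X" "x \<noteq> y" "x \<noteq> z" "y \<noteq> z"
proof -
  obtain T where "T \<subseteq> X" "card T = 3"
    using obtain_subset_with_card_n[of 3 X] assms by auto
  then show ?thesis
    using that by (auto simp: card_3_iff)
qed

text \<open>Deleting a vertex of degree at most 2 costs at most two edges. The degree condition
  ranges over all \<open>T\<close> so that it survives the deletion.\<close>

lemma card_edges_two_degenerate:
  assumes "finite S" "2 \<le> card S"
    and "E \<subseteq> {e. e \<subseteq> S \<and> card e = 2}"
    and "\<And>T. T \<subseteq> S \<Longrightarrow> T \<noteq> {} \<Longrightarrow> \<exists>u\<in>T. card {w \<in> T. {u, w} \<in> E} \<le> 2"
  shows "card E + 3 \<le> 2 * card S"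
  using assms
proof (induction "card S" arbitrary: S E)
  case 0
  then show ?case by simp
next
  case (Suc n)
  show ?case
  \<comment> \<open>The real base is \<open>card S = 2\<close>, where \<open>S\<close> itself is the
    only possible edge; the 3 in the bound comes from here.\<close>
  proof (cases "n = 1")
    case True
    then have "e = S" if "e \<in> E" for e
      using Suc.hyps(2) Suc.prems that card_subset_eq[of S e] by auto
    then have "E \<subseteq> {S}"
      by auto
    then have "card E \<le> 1"
      using card_mono[of "{S}" E] by simp
    then show ?thesis using True Suc.hyps by simp
  next
    case False
    obtain u where u: "u \<in> S" "card {w \<in> S. {u, w} \<in> E} \<le> 2"
      using Suc.prems(2) Suc.prems(4)[of S] by fastforce
    define E' where "E' = {e \<in> E. u \<notin> e}"
    have finE: "finite E"
      using Suc.prems by (auto intro: finite_subset[of E "Pow S"])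
    have "card E' + 3 \<le> 2 * card (S - {u})"
    proof (rule Suc.hyps)
      show "n = card (S - {u})" "2 \<le> card (S - {u})"
        using Suc.hyps Suc.prems u False by auto
      show "E' \<subseteq> {e. e \<subseteq> S - {u} \<and> card e = 2}"
        using Suc.prems by (auto simp: E'_def)
      show "\<exists>t\<in>T. card {w \<in> T. {t, w} \<in> E'} \<le> 2" if T: "T \<subseteq> S - {u}" "T \<noteq> {}" for T
      proof -
        obtain t where "t \<in> T" "card {w \<in> T. {t, w} \<in> E} \<le> 2"
          using Suc.prems(4)[of T] T by auto
        moreover have "{w \<in> T. {t, w} \<in> E'} = {w \<in> T. {t, w} \<in> E}"
          using T \<open>t \<in> T\<close> by (auto simp: E'_def)
        ultimately show ?thesis
          using \<open>t \<in> T\<close> by (intro bexI[of _ t]) simp_all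
      qed
      show "finite (S - {u})"
        using Suc.prems(1) by simp
    qed
    moreover have "card (E - E') \<le> 2"
    proof -
      have "E - E' \<subseteq> (\<lambda>w. {u, w}) ` {w \<in> S. {u, w} \<in> E}"
      proof
        fix e assume e: "e \<in> E - E'"
        then have "card e = 2" "u \<in> e" "e \<subseteq> S" "e \<in> E"
          using Suc.prems by (auto simp: E'_def)
        then obtain w where "e = {u, w}"
          by (auto simp: card_2_iff)
        with \<open>e \<subseteq> S\<close> \<open>e \<in> E\<close> show "e \<in> (\<lambda>w. {u, w}) ` {w \<in> S. {u, w} \<in> E}"
          by auto
      qed
      then have "card (E - E') \<le> card {w \<in> S. {u, w} \<in> E}"
        using Suc.prems(1) by (intro surj_card_le) auto
      with u show ?thesis by simp
    qed
    moreover have "card E = card E' + card (E - E')"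
    proof -
      have "E' \<subseteq> E"
        by (auto simp: E'_def)
      then show ?thesis
        using finE by (metis card_Diff_subset card_mono finite_subset le_add_diff_inverse)
    qed
    ultimately show ?thesis
      using Suc.prems u by simp
  qed
qed

section \<open>Intervals joining two members of a family\<close>

definition joins :: "veto_interval \<Rightarrow> 'i set \<Rightarrow> ('i \<Rightarrow> veto_interval) \<Rightarrow> 'i \<Rightarrow> 'i \<Rightarrow> bool" where
  "joins b S A i j \<longleftrightarrow>
     is_veto_interval b \<and> (\<forall>k\<in>S. veto_adjacent b (A k) \<longleftrightarrow> k = i \<or> k = j)"

lemma joins_mirror: "joins b S A i j \<Longrightarrow> joins (mirror b) S (\<lambda>k. mirror (A k)) i j"
  by (simp add: joins_def)

lemma joins_subset: "joins b S A i j \<Longrightarrow> T \<subseteq> S \<Longrightarrow> joins b T A i j"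
  by (auto simp: joins_def)

lemma not_precedes_joins:
  assumes "joins b S A i j" "k \<in> S" "k \<noteq> i" "k \<noteq> j"
  shows "\<not> precedes b (A k)" "\<not> precedes (A k) b"
  using assms by (auto simp: joins_def veto_adjacent_iff)

definition left_pairs :: "'i set \<Rightarrow> ('i \<Rightarrow> veto_interval) \<Rightarrow> 'i set set" where
  "left_pairs S A = {{i, j} | i j. i \<in> S \<and> j \<in> S \<and> i \<noteq> j \<and>
     (\<exists>b. joins b S A i j \<and> precedes b (A i) \<and> precedes b (A j))}"

definition right_pairs :: "'i set \<Rightarrow> ('i \<Rightarrow> veto_interval) \<Rightarrow> 'i set set" where
  "right_pairs S A = {{i, j} | i j. i \<in> S \<and> j \<in> S \<and> i \<noteq> j \<and>
     (\<exists>b. joins b S A i j \<and> precedes (A i) b \<and> precedes (A j) b)}"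

lemma joins_commute: "joins b S A i j \<longleftrightarrow> joins b S A j i"
  by (auto simp: joins_def)

lemma left_pairs_iff: "{i, j} \<in> left_pairs S A \<longleftrightarrow> i \<in> S \<and> j \<in> S \<and> i \<noteq> j \<and>
     (\<exists>b. joins b S A i j \<and> precedes b (A i) \<and> precedes b (A j))"
  unfolding left_pairs_def by (auto simp: doubleton_eq_iff joins_commute)

lemma right_pairs_iff: "{i, j} \<in> right_pairs S A \<longleftrightarrow> i \<in> S \<and> j \<in> S \<and> i \<noteq> j \<and>
     (\<exists>b. joins b S A i j \<and> precedes (A i) b \<and> precedes (A j) b)"
  unfolding right_pairs_def by (auto simp: doubleton_eq_iff joins_commute)

text \<open>Since \<open>v\<close> precedes every \<open>A i\<close>, the point
  \<open>right v\<close> separates all left ends from all veto marks. If \<open>u\<close> has the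
  least left end in \<open>T\<close>, the veto mark of any \<open>b\<close> preceding
  \<open>A u\<close> is below every left end in \<open>T\<close>, so only the position of
  \<open>right b\<close> can keep \<open>b\<close> from preceding \<open>A w\<close>.\<close>

lemma card_left_pairs:
  assumes fin: "finite S" "2 \<le> card S" and pre: "\<And>i. i \<in> S \<Longrightarrow> precedes v (A i)"
  shows "card (left_pairs S A) + 3 \<le> 2 * card S"
proof (rule card_edges_two_degenerate[OF fin])
  show "left_pairs S A \<subseteq> {e. e \<subseteq> S \<and> card e = 2}"
    by (auto simp: left_pairs_def)
  fix T assume T: "T \<subseteq> S" "T \<noteq> {}"
  then obtain u where u: "u \<in> T" "\<And>w. w \<in> T \<Longrightarrow> left (A u) \<le> left (A w)"
    using ex_min_if_finite[of "(\<lambda>w. left (A w)) ` T"] finite_subset[OF T(1) fin(1)]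
    by (metis (no_types, lifting) arg_min_if_finite(1) arg_min_if_finite(2) linorder_not_less)
  let ?X = "{w \<in> T. {u, w} \<in> left_pairs S A}"
  have no_chain: False
    if w: "w1 \<in> ?X" "w2 \<in> ?X" "w3 \<in> ?X" "w1 \<noteq> w2" "w1 \<noteq> w3" "w2 \<noteq> w3"
      and le: "left (A w1) \<le> left (A w2)" "left (A w2) \<le> left (A w3)" for w1 w2 w3
  proof -
    obtain b c where
      b: "joins b S A u w2" "precedes b (A u)" "precedes b (A w2)" and
      c: "joins c S A u w3" "precedes c (A u)" "precedes c (A w3)"
      using w by (auto simp: left_pairs_iff)
    have "w1 \<noteq> u" "w2 \<noteq> u" "w3 \<noteq> u" "w1 \<in> S" "w2 \<in> S" "w3 \<in> S"
      using w by (auto simp: left_pairs_iff)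
    then have nb: "\<not> precedes b (A w1)" "\<not> precedes b (A w3)" "\<not> precedes c (A w2)"
      using not_precedes_joins[OF b(1)] not_precedes_joins[OF c(1)] w(4-6) by auto
    have "left (A u) \<le> left (A w1)" "precedes v (A w1)" "precedes v (A w3)"
      using u w pre \<open>w1 \<in> S\<close> \<open>w3 \<in> S\<close> by auto
    \<comment> \<open>From \<open>w1\<close>:
      \<open>left (A w3) < right v < veto (A w1) \<le> right b\<close>. So \<open>b\<close> can miss
      \<open>A w3\<close> only by reaching its veto mark.\<close>
    then have "veto (A w3) \<le> right b"
      using b nb le by (auto simp: precedes_def)
    moreover have "veto (A w2) \<le> right c"
      using c nb le \<open>left (A u) \<le> left (A w1)\<close> by (auto simp: precedes_def)
    \<comment> \<open>The cycle is \<open>right b < veto (A w2) \<le> right c < veto (A w3) \<le>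
      right b\<close>.\<close>
    ultimately show False
      using b c by (auto simp: precedes_def)
  qed
  have "card ?X \<le> 2"
  proof (rule ccontr)
    assume "\<not> card ?X \<le> 2"
    then have "2 < card ?X"
      by simp
    then obtain x y z where "x \<in> ?X" "y \<in> ?X" "z \<in> ?X" "x \<noteq> y" "x \<noteq> z" "y \<noteq> z"
      by (rule card_gt_2_obtain)
    then show False
      using no_chain[of x y z] no_chain[of x z y] no_chain[of y x z]
        no_chain[of y z x] no_chain[of z x y] no_chain[of z y x] by argo
  qed
  with u show "\<exists>u\<in>T. card {w \<in> T. {u, w} \<in> left_pairs S A} \<le> 2"
    by blast
qed

text \<open>If \<open>u\<close> has the greatest veto mark in \<open>T\<close>, the left end of any
  \<open>b\<close> preceded by \<open>A u\<close> is beyond all veto marks in \<open>T\<close>. So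
  \<open>A w'\<close> fails to precede \<open>b\<close> only if its right end is at most
  \<open>left b\<close> or at least \<open>veto b\<close>, hence outside the span of the right ends
  of the two joined intervals.\<close>

lemma card_right_pairs:
  assumes fin: "finite S" "2 \<le> card S"
  shows "card (right_pairs S A) + 3 \<le> 2 * card S"
proof (rule card_edges_two_degenerate[OF fin])
  show "right_pairs S A \<subseteq> {e. e \<subseteq> S \<and> card e = 2}"
    by (auto simp: right_pairs_def)
  fix T assume T: "T \<subseteq> S" "T \<noteq> {}"
  then obtain u where u: "u \<in> T" "\<And>w. w \<in> T \<Longrightarrow> veto (A w) \<le> veto (A u)"
    using arg_min_if_finite[of T "\<lambda>w. - veto (A w)"] finite_subset[OF T(1) fin(1)]
    by (metis (no_types, lifting) linorder_not_less neg_less_iff_less)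
  let ?X = "{w \<in> T. {u, w} \<in> right_pairs S A}"
  have apart: "right (A w') < min (right (A u)) (right (A w)) \<or>
      max (right (A u)) (right (A w)) < right (A w')"
    if w: "w \<in> ?X" "w' \<in> ?X" "w \<noteq> w'" for w w'
  proof -
    obtain b where b: "joins b S A u w" "precedes (A u) b" "precedes (A w) b"
      using w by (auto simp: right_pairs_iff)
    have "\<not> precedes (A w') b"
      using not_precedes_joins(2)[OF b(1)] w by (auto simp: right_pairs_iff)
    then show ?thesis
      using b u(2)[of w'] w by (auto simp: precedes_def)
  qed
  have "card ?X \<le> 2"
  proof (rule ccontr)
    assume "\<not> card ?X \<le> 2"
    then have "2 < card ?X"
      by simp
    then obtain x y z where "x \<in> ?X" "y \<in> ?X" "z \<in> ?X" "x \<noteq> y" "x \<noteq> z" "y \<noteq> z"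
      by (rule card_gt_2_obtain)
    \<comment> \<open>Two of the three right ends lie weakly on the same side of
      \<open>right (A u)\<close>; the nearer one contradicts \<open>apart\<close>.\<close>
    then show False
      using apart[of x y] apart[of y x] apart[of x z] apart[of z x] apart[of y z] apart[of z y]
      by (auto simp: min_def max_def split: if_splits)
  qed
  with u show "\<exists>u\<in>T. card {w \<in> T. {u, w} \<in> right_pairs S A} \<le> 2"
    by blast
qed

text \<open>Eight is the least \<open>n \<ge> 2\<close> with
  \<open>n * (n - 1) / 2 > 2 * (2 * n - 3)\<close>.\<close>

lemma card_one_side_less:
  assumes pre: "\<And>i. i \<in> S \<Longrightarrow> precedes v (A i)"
    and joined: "\<And>i j. i \<in> S \<Longrightarrow> j \<in> S \<Longrightarrow> i \<noteq> j \<Longrightarrow> \<exists>b. joins b S A i j"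
  shows "card S < 8"
proof (rule ccontr)
  assume "\<not> card S < 8"
  then obtain T where T: "T \<subseteq> S" "card T = 8"
    using obtain_subset_with_card_n[of 8 S] by auto
  then have fin: "finite T"
    using card.infinite by fastforce
  have "{e. e \<subseteq> T \<and> card e = 2} \<subseteq> left_pairs T A \<union> right_pairs T A"
  proof
    fix e assume "e \<in> {e. e \<subseteq> T \<and> card e = 2}"
    then obtain i j where e: "e = {i, j}" "i \<noteq> j" "i \<in> T" "j \<in> T"
      by (auto simp: card_2_iff)
    then obtain b where "joins b S A i j"
      using joined[of i j] T(1) by auto
    then have b: "joins b T A i j"
      using T(1) by (rule joins_subset)
    have "precedes v (A i)" "precedes v (A j)"
      using pre e T by auto
    moreover have "is_veto_interval b" "veto_adjacent b (A i)" "veto_adjacent b (A j)"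
      using b e by (auto simp: joins_def)
    \<comment> \<open>A mixed case would give
      \<open>veto b < left (A i) < right v < veto (A j) < left b\<close>, or the same with
      \<open>i\<close> and \<open>j\<close> exchanged.\<close>
    ultimately have "precedes b (A i) \<and> precedes b (A j) \<or> precedes (A i) b \<and> precedes (A j) b"
      by (auto simp: veto_adjacent_iff precedes_def is_veto_interval_def)
    then show "e \<in> left_pairs T A \<union> right_pairs T A"
      using e b by (auto simp: left_pairs_iff right_pairs_iff)
  qed
  moreover have "finite (left_pairs T A)" "finite (right_pairs T A)"
    using fin by (auto simp: left_pairs_def right_pairs_def intro!: finite_subset[of _ "Pow T"])
  ultimately have "card {e. e \<subseteq> T \<and> card e = 2} \<le> card (left_pairs T A) + card (right_pairs T A)"
    by (meson card_Un_le card_mono finite_UnI le_trans)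
  also have "\<dots> \<le> 26"
  proof -
    have "precedes v (A k)" if "k \<in> T" for k
      using pre T(1) that by auto
    then show ?thesis
      using card_left_pairs[of T v A] card_right_pairs[of T A] fin T(2) by simp
  qed
  finally show False
    using n_subsets[OF fin, of 2] T by (simp add: choose_two)
qed

section \<open>Neighbours on both sides of \<open>v\<close>\<close>

lemma veto_crossing_joiner:
  assumes pre: "\<And>k. k \<in> P \<Longrightarrow> precedes v (A k)" and P: "2 < card P"
  obtains i where "i \<in> P"
    and "\<And>b j. joins b (insert j P) A i j \<Longrightarrow> j \<notin> P \<Longrightarrow> precedes b (A i) \<Longrightarrow> veto v < veto b"
proof -
  have fin: "finite P" "P \<noteq> {}"
    using P card.infinite by fastforce+
  obtain p where p: "p \<in> P" "\<And>k. k \<in> P \<Longrightarrow> left (A p) \<le> left (A k)"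
    using arg_min_if_finite[OF fin, of "\<lambda>k. left (A k)"] by (metis linorder_not_less)
  obtain q where q: "q \<in> P" "\<And>k. k \<in> P \<Longrightarrow> veto (A k) \<le> veto (A q)"
    using arg_min_if_finite[OF fin, of "\<lambda>k. - veto (A k)"]
    by (metis linorder_not_less neg_less_iff_less)
  have "\<not> P \<subseteq> {p, q}"
    using P card_mono[of "{p, q}" P] card_insert_le_m1[of 2 "{q}" p] by auto
  then obtain i where i: "i \<in> P" "i \<noteq> p" "i \<noteq> q"
    by auto
  show ?thesis
  proof (rule that[OF i(1)])
    fix b j assume b: "joins b (insert j P) A i j" "j \<notin> P" "precedes b (A i)"
    have "\<not> precedes b (A p)" "\<not> precedes b (A q)"
      using not_precedes_joins(1)[OF b(1)] b(2) i p(1) q(1) by auto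
    \<comment> \<open>Otherwise \<open>veto b\<close> is below all left ends in \<open>P\<close>. As
      \<open>left (A p) < right b < veto (A q)\<close>, missing both intervals forces
      \<open>veto (A p) \<le> right b \<le> left (A q)\<close>, although \<open>right v\<close>
      separates \<open>left (A q)\<close> from \<open>veto (A p)\<close>.\<close>
    then show "veto v < veto b"
      using b(3) p(2)[OF i(1)] q(2)[OF i(1)] pre[OF p(1)] pre[OF q(1)]
      by (auto simp: precedes_def)
  qed
qed

text \<open>\<open>veto_crossing_joiner\<close> applies to \<open>P\<close> and to the reflected
  \<open>N\<close>. It constrains \<open>b\<close> only on one side and at the partner index, so a
  joiner over \<open>P \<union> N\<close> serves both uses.\<close>

lemma card_some_side_le:
  assumes v: "is_veto_interval v"
    and P: "\<And>k. k \<in> P \<Longrightarrow> precedes v (A k)" and N: "\<And>k. k \<in> N \<Longrightarrow> precedes (A k) v"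
    and joined: "\<And>i j. i \<in> P \<Longrightarrow> j \<in> N \<Longrightarrow> i \<noteq> j \<Longrightarrow> \<exists>b. joins b (P \<union> N) A i j"
  shows "card P \<le> 2 \<or> card N \<le> 2"
proof (rule ccontr)
  assume "\<not> ?thesis"
  then have card: "2 < card P" "2 < card N" by auto
  obtain i where i: "i \<in> P"
    "\<And>b j. joins b (insert j P) A i j \<Longrightarrow> j \<notin> P \<Longrightarrow> precedes b (A i) \<Longrightarrow> veto v < veto b"
    using veto_crossing_joiner[where P = P and v = v and A = A, OF P card(1)] by blast
  have "precedes (mirror v) (mirror (A k))" if "k \<in> N" for k
    using N[OF that] by simp
  from veto_crossing_joiner[where P = N and v = "mirror v" and A = "\<lambda>k. mirror (A k)", OF this card(2)]
  obtain j where j: "j \<in> N"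
    "\<And>b i. joins b (insert i N) (\<lambda>k. mirror (A k)) j i \<Longrightarrow> i \<notin> N \<Longrightarrow>
       precedes b (mirror (A j)) \<Longrightarrow> veto (mirror v) < veto b"
    by blast
  have disj: "k \<notin> N" if "k \<in> P" for k
    using P[OF that] N[of k] v by (auto simp: precedes_def is_veto_interval_def)
  with i j have ij: "i \<notin> N" "j \<notin> P" "i \<noteq> j" by auto
  then obtain b where b: "joins b (P \<union> N) A i j"
    using joined i j by blast
  then have "is_veto_interval b" "veto_adjacent b (A i)" "veto_adjacent b (A j)"
    using i j by (auto simp: joins_def)
  \<comment> \<open>If \<open>A i\<close> preceded \<open>b\<close>, then \<open>left b\<close>
    would exceed \<open>right v\<close>, out of reach of \<open>A j\<close>, which ends before
    \<open>veto v\<close>. Symmetrically, if \<open>b\<close> preceded \<open>A j\<close>, it would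
    end before \<open>left v\<close> and miss \<open>A i\<close>.\<close>
  then have "precedes b (A i) \<and> precedes (A j) b"
    using P[OF i(1)] N[OF j(1)] v by (auto simp: veto_adjacent_iff precedes_def is_veto_interval_def)
  moreover have "joins b (insert j P) A i j"
    using b j(1) by (auto intro: joins_subset)
  moreover have "joins (mirror b) (insert i N) (\<lambda>k. mirror (A k)) j i"
  proof (rule joins_mirror)
    have "joins b (P \<union> N) A j i"
      using b by (rule joins_commute[THEN iffD1])
    then show "joins b (insert i N) A j i"
      using i(1) by (auto intro: joins_subset)
  qed
  ultimately show False
    using i(2)[of b j] j(2)[of "mirror b" i] ij by simp
qed

section \<open>Application to \<open>G10\<close>\<close>

lemma G10_arcs_iff:
  "(Vv, Va k) \<in> parcs G10 \<longleftrightarrow> 1 \<le> k \<and> k \<le> 10"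
  "(Vb i j, Va k) \<in> parcs G10 \<longleftrightarrow> 1 \<le> i \<and> i < j \<and> j \<le> 10 \<and> (k = i \<or> k = j)"
  by (auto simp: G10_def G10_edges_def)

theorem theorem9:
  shows "\<not> veto_interval_graph G10"
proof
  assume "veto_interval_graph G10"
  then obtain I where I: "veto_interval_representation G10 I"
    by (auto simp: veto_interval_graph_def)
  define A where "A k = I (Va k)" for k
  define v where "v = I Vv"
  have verts: "Vv \<in> pverts G10" "\<And>k. k \<in> {1..10} \<Longrightarrow> Va k \<in> pverts G10"
    "\<And>i j. 1 \<le> i \<Longrightarrow> i < j \<Longrightarrow> j \<le> 10 \<Longrightarrow> Vb i j \<in> pverts G10"
    by (auto simp: G10_def G10_verts_def)
  have ivl: "is_veto_interval (I a)" if "a \<in> pverts G10" for a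
    using I that by (auto simp: veto_interval_representation_def)
  have adj: "veto_adjacent (I a) (I b) \<longleftrightarrow> a \<rightarrow>\<^bsub>G10\<^esub> b"
    if "a \<in> pverts G10" "b \<in> pverts G10" "a \<noteq> b" for a b
    using I that by (auto simp: veto_interval_representation_def)
  have v: "is_veto_interval v"
    using ivl verts by (simp add: v_def)
  have joins_less: "joins (I (Vb i j)) {1..10} A i j" if "1 \<le> i" "i < j" "j \<le> 10" for i j
    using that verts ivl adj by (auto simp: joins_def A_def G10_arcs_iff)
  \<comment> \<open>The indices of \<open>Vb\<close> are increasing; symmetry of
    \<open>joins\<close> covers the other order.\<close>
  have joined: "\<exists>b. joins b T A i j" if T: "T \<subseteq> {1..10}" "i \<in> T" "j \<in> T" "i \<noteq> j" for T i j
  proof -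
    have "i \<in> {1..10}" "j \<in> {1..10}"
      using T by auto
    then obtain b where "joins b {1..10} A i j"
      using \<open>i \<noteq> j\<close> joins_less[of i j] joins_less[of j i] joins_commute[of _ _ A i j]
      by (metis atLeastAtMost_iff linorder_neqE_nat)
    then have "joins b T A i j"
      using T(1) by (rule joins_subset)
    then show ?thesis ..
  qed
  define P where "P = {k \<in> {1..10}. precedes v (A k)}"
  define N where "N = {k \<in> {1..10}. precedes (A k) v}"
  have "precedes v (A k) \<or> precedes (A k) v" if "k \<in> {1..10}" for k
    using adj[of Vv "Va k"] verts that by (auto simp: v_def A_def G10_arcs_iff veto_adjacent_iff)
  then have PN: "P \<union> N = {1..10}"
    unfolding P_def N_def by blast
  have "card P < 8"
  proof (rule card_one_side_less[of P v A])
    show "precedes v (A i)" if "i \<in> P" for i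
      using that by (simp add: P_def)
    show "\<exists>b. joins b P A i j" if "i \<in> P" "j \<in> P" "i \<noteq> j" for i j
      using joined[of P i j] that PN by blast
  qed
  moreover have "card N < 8"
  proof (rule card_one_side_less[of N "mirror v" "\<lambda>k. mirror (A k)"])
    show "precedes (mirror v) (mirror (A i))" if "i \<in> N" for i
      using that by (simp add: N_def)
    show "\<exists>b. joins b N (\<lambda>k. mirror (A k)) i j" if "i \<in> N" "j \<in> N" "i \<noteq> j" for i j
      using joined[of N i j] that PN joins_mirror[of _ N A i j] by blast
  qed
  moreover have "card P \<le> 2 \<or> card N \<le> 2"
  proof (rule card_some_side_le[OF v])
    show "precedes v (A k)" if "k \<in> P" for k
      using that by (simp add: P_def)
    show "precedes (A k) v" if "k \<in> N" for k
      using that by (simp add: N_def)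
    show "\<exists>b. joins b (P \<union> N) A i j" if "i \<in> P" "j \<in> N" "i \<noteq> j" for i j
      using joined[of "P \<union> N" i j] that PN by blast
  qed
  moreover have "card (P \<union> N) \<le> card P + card N"
    by (rule card_Un_le)
  \<comment> \<open>One side has at most 2 members and the other at most 7, fewer than 10
    together.\<close>
  ultimately show False
    by (simp add: PN)
qed

end
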